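(* Let $f : (0,\infty) \to \mathbb{R}$ be a continuous function such that, for every $x > 0$, the limit $\lim_{n\to\infty} f(nx)$ exists in $\mathbb{R}$. Then the limit $\lim_{x\to\infty} f(x)$ exists in $\mathbb{R}$.
   Context: Here $n$ ranges over the positive integers $\mathbb{N}=\{1,2,\ldots\}$ and "the limit exists" means that it exists as a finite real number. The limits $\lim_{n\to\infty} f(nx)$ are not assumed to be equal for different $x$. *)

theory Defs
  imports "HOL-Analysis.Analysis"
begin

end

theory Submission
  imports Defs
begin

text \<open>
  It suffices to verify the Cauchy criterion for \<open>f\<close> at infinity.  Fix \<open>e > 0\<close>.  Since
  every sequence \<open>f (n x)\<close> is Cauchy, the interval \<open>[1, 2]\<close> is the union over \<open>N \<ge> 1\<close> of the
  closed sets of those \<open>x\<close> for which \<open>f (n x)\<close> stays within \<open>e\<close> of \<open>f (N x)\<close> for all \<open>n \<ge> N\<close>.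
  By the Baire category theorem one of these sets has an interior point \<open>c\<close>, and continuity of
  \<open>f\<close> at \<open>N c\<close> gives an interval \<open>[a, b]\<close> around \<open>c\<close> on which, for a single \<open>N\<close>, all values
  \<open>f (n x)\<close> with \<open>n \<ge> N\<close> lie within \<open>2 e\<close> of the single number \<open>f (N c)\<close>
  (lemma \<open>dilates_uniformly_close_on_interval\<close>).

  The dilates \<open>n [a, b]\<close> overlap once \<open>n\<close> is large, so those with \<open>n \<ge> N\<close> cover a
  neighbourhood of infinity (lemma \<open>dilates_cover_at_top\<close>).  Hence \<open>f\<close> itself is eventually
  within \<open>2 e\<close> of \<open>f (N c)\<close>.  All values are compared with the one number
  \<open>f (N c)\<close>; this is what ties together the limits along different \<open>x\<close>.
\<close>

lemma dilates_cover_at_top: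
  fixes a b :: real and N :: nat
  assumes "0 < a" "a < b"
  shows "\<forall>\<^sub>F y in at_top. \<exists>n\<ge>N. \<exists>x\<in>{a..b}. y = real n * x"
proof -
  have "\<forall>\<^sub>F y in at_top. y \<ge> a * (real N + 1) \<and> y \<ge> a * b / (b - a)"
    by (intro eventually_conj eventually_ge_at_top)
  then show ?thesis
  proof eventually_elim
    case (elim y)
    have big: "y / a \<ge> real N + 1"
      using elim assms by (simp add: field_simps)
    then have pos: "y / a \<ge> 0" by linarith
    \<comment> \<open>The largest \<open>n\<close> with \<open>n * a \<le> y\<close>; a quotient \<open>y / n\<close> above \<open>b\<close> would force
      \<open>y / b > y / a - 1\<close>, which the second lower bound on \<open>y\<close> excludes.\<close>
    define n where "n = nat \<lfloor>y / a\<rfloor>"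
    have n_le: "real n \<le> y / a" and n_gt: "y / a < real n + 1"
      unfolding n_def using pos by linarith+
    have nN: "n \<ge> N" and n0: "real n > 0"
      using big n_gt by linarith+
    have "a * b \<le> y * (b - a)"
      using elim assms by (simp add: pos_divide_le_eq)
    then have "y / b \<le> y / a - 1"
      using assms by (simp add: field_simps)
    then have "y / b \<le> real n"
      using n_gt by linarith
    then have "y / real n \<in> {a..b}"
      using n_le n0 assms by (simp add: field_simps)
    moreover have "y = real n * (y / real n)"
      using n0 by simp
    ultimately show ?case
      using nN by blast
  qed
qed

text \<open>
  This is where the category argument enters: pointwise convergence along each
  \<open>n \<mapsto> f (n x)\<close> becomes uniform in \<open>x\<close> on some interval, up to the error \<open>e\<close>.
\<close>

lemma dilates_uniformly_close_on_interval:
  fixes f :: "real \<Rightarrow> real"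
  assumes cont: "continuous_on {0<..} f"
    and conv: "\<And>x. x > 0 \<Longrightarrow> convergent (\<lambda>n. f (real n * x))"
    and e: "e > 0"
  obtains a b N v where "0 < a" "a < b"
    "\<And>n x. n \<ge> N \<Longrightarrow> x \<in> {a..b} \<Longrightarrow> \<bar>f (real n * x) - v\<bar> \<le> 2 * e"
proof -
  define A where
    "A N = {x\<in>{1..2}. \<forall>n\<ge>N. \<bar>f (real n * x) - f (real N * x)\<bar> \<le> e}" for N :: nat
  have cont_dil: "continuous_on {0<..} (\<lambda>x. f (real n * x))" if "n > 0" for n :: nat
    by (rule continuous_on_compose2[OF cont]) (use that in \<open>auto intro!: continuous_intros\<close>)
  have closed_A: "closed (A N)" if "N > 0" for N
  proof -
    have "closed {x\<in>{1..2}. \<bar>f (real n * x) - f (real N * x)\<bar> \<le> e}" if "n \<ge> N" for n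
    proof -
      have "continuous_on {1..2} (\<lambda>x. \<bar>f (real n * x) - f (real N * x)\<bar>)"
        using that \<open>N > 0\<close>
        by (intro continuous_intros continuous_on_subset[OF cont_dil]) auto
      then show ?thesis
        by (intro continuous_on_closed_Collect_le) auto
    qed
    then have "closed ({1..2} \<inter>
        (\<Inter>n\<in>{N..}. {x\<in>{1..2}. \<bar>f (real n * x) - f (real N * x)\<bar> \<le> e}))"
      by (intro closed_Int closed_INT) auto
    also have "\<dots> = A N"
      by (auto simp: A_def)
    finally show ?thesis .
  qed
  have cover: "{1..2} \<subseteq> (\<Union>N\<in>{0<..}. A N)"
  proof
    fix x :: real
    assume x: "x \<in> {1..2}"
    then have "Cauchy (\<lambda>n. f (real n * x))"
      using conv[of x] by (simp add: convergent_Cauchy)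
    then obtain M where M: "\<And>m n. m \<ge> M \<Longrightarrow> n \<ge> M \<Longrightarrow> dist (f (real m * x)) (f (real n * x)) < e"
      using metric_CauchyD[OF _ e] by metis
    have "x \<in> A (Suc M)"
      using x M[of _ "Suc M"] by (auto simp: A_def dist_real_def intro: less_imp_le)
    then show "x \<in> (\<Union>N\<in>{0<..}. A N)" by blast
  qed
  have "\<exists>N>0. interior (A N) \<noteq> {}"
  proof (rule ccontr)
    assume "\<not> ?thesis"
    then have "interior (A N) = {}" if "N > 0" for N
      using that by blast
    then have "euclidean interior_of (\<Union>(A ` {0<..})) = {}"
      using closed_A
      by (intro Baire_category_alt) (auto simp: completely_metrizable_space_euclidean)
    moreover have "interior {1..2::real} \<subseteq> interior (\<Union>(A ` {0<..}))"
      by (rule interior_mono[OF cover])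
    ultimately show False
      by simp
  qed
  then obtain N c where N: "N > 0" and c: "c \<in> interior (A N)" by blast
  have "c \<in> {1..2}"
    using c interior_subset[of "A N"] by (auto simp: A_def)
  then have "isCont (\<lambda>x. f (real N * x)) c"
    using cont_dil[OF N] by (intro continuous_on_interior) (auto simp: interior_open)
  then have "\<forall>\<^sub>F x in nhds c. dist (f (real N * x)) (f (real N * c)) < e"
    using e by (intro tendstoD) (simp_all add: isCont_def tendsto_nhds_iff)
  moreover have "\<forall>\<^sub>F x in nhds c. x \<in> interior (A N)"
    using c by (intro eventually_nhds_in_open) auto
  ultimately have
    "\<forall>\<^sub>F x in nhds c. dist (f (real N * x)) (f (real N * c)) < e \<and> x \<in> interior (A N)"
    by (rule eventually_conj)
  then obtain d where d: "d > 0"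
    and near: "\<And>x. dist x c < d \<Longrightarrow> dist (f (real N * x)) (f (real N * c)) < e \<and> x \<in> A N"
    unfolding eventually_nhds_metric using interior_subset by blast
  show thesis
  proof (rule that)
    \<comment> \<open>\<open>A N \<subseteq> [1, 2]\<close>, so starting the interval at \<open>c \<ge> 1\<close> keeps it positive.\<close>
    show "0 < c" "c < c + d / 2"
      using \<open>c \<in> {1..2}\<close> d by auto
    fix n x
    assume n: "n \<ge> N" and "x \<in> {c..c + d / 2}"
    then have "dist x c < d"
      using d by (auto simp: dist_real_def)
    from near[OF this] have "\<bar>f (real N * x) - f (real N * c)\<bar> < e"
      and "\<bar>f (real n * x) - f (real N * x)\<bar> \<le> e"
      using n by (auto simp: A_def dist_real_def)
    then show "\<bar>f (real n * x) - f (real N * c)\<bar> \<le> 2 * e"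
      by linarith
  qed
qed

theorem mainTheorem1:
  fixes f :: "real \<Rightarrow> real"
  assumes "continuous_on {0<..} f"
    and "\<And>x. x > 0 \<Longrightarrow> \<exists>L. (\<lambda>n::nat. f (real n * x)) \<longlonglongrightarrow> L"
  shows "\<exists>L. (f \<longlongrightarrow> L) at_top"
proof -
  have "cauchy_filter (filtermap f at_top)"
    unfolding cauchy_filter_metric_filtermap
  proof (intro allI impI)
    fix e :: real
    assume "e > 0"
    \<comment> \<open>Two values within \<open>2 * (e / 5)\<close> of a common \<open>v\<close> differ by less than \<open>e\<close>.\<close>
    then have "e / 5 > 0" by simp
    moreover have "convergent (\<lambda>n. f (real n * x))" if "x > 0" for x
      using assms(2)[OF that] by (simp add: convergent_def)
    ultimately obtain a b N v where ab: "0 < a" "a < b"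
      and close: "\<And>n x. n \<ge> N \<Longrightarrow> x \<in> {a..b} \<Longrightarrow> \<bar>f (real n * x) - v\<bar> \<le> 2 * (e / 5)"
      using dilates_uniformly_close_on_interval[OF assms(1), of "e / 5"] by blast
    have "\<forall>\<^sub>F y in at_top. \<bar>f y - v\<bar> \<le> 2 * (e / 5)"
      using dilates_cover_at_top[OF ab, of N] by eventually_elim (use close in blast)
    moreover have "dist (f y) (f z) < e"
      if "\<bar>f y - v\<bar> \<le> 2 * (e / 5)" "\<bar>f z - v\<bar> \<le> 2 * (e / 5)" for y z
      using that \<open>e > 0\<close> unfolding dist_real_def by linarith
    ultimately show "\<exists>P. eventually P at_top \<and> (\<forall>x y. P x \<and> P y \<longrightarrow> dist (f x) (f y) < e)"
      by blast
  qed
  then have "convergent_filter (filtermap f at_top)"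
    by (simp add: convergent_filter_iff_cauchy)
  then show ?thesis
    by (simp add: convergent_filter_iff filterlim_def)
qed

end
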